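(* Let $S$ be a subsemigroup of $((0,\infty),+)$ which is dense in $(0,\infty)$ and let $B,M\in\mathcal M_0(S)$, where $B$ is $\alpha\times\delta$ and $M$ is $\gamma\times\mu$. Then $\begin{pmatrix}\bar 1&B&0\\\bar 0&0&M\end{pmatrix}\in\mathcal M_0(S)$, where $\bar 1$ is the $\alpha\times1$ column with all entries $1$ and $\bar 0$ is the $\gamma\times 1$ zero column.
   Context: Matrices have rows and columns indexed by positive countable ordinals. A matrix is admissible if its entries are rational, no row is $\vec 0$, and each row has finitely many nonzero entries. $\beta S$ is the set of ultrafilters on $S$, with $B\in p+q$ iff $\{x\in S:-x+B\in q\}\in p$; $\overline C=\{p\in\beta S:C\in p\}$. $O^+(S)=\{p\in\beta S:(0,\varepsilon)\cap S\in p$ for all $\varepsilon>0\}$. $T\subseteq S$ is thick near zero if $L\subseteq\overline T$ for some left ideal $L$ of $O^+(S)$. $\mathcal M_0(S)$ is the set of admissible matrices $N$ (of some size $\alpha'\times\delta'$) such that whenever $T$ is thick near zero in $S$ and finitely colored, there is $\vec x\in S^{\delta'}$ with all entries of $N\vec x$ in one color class of $T$. *)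

theory Defs
  imports "HOL-Analysis.Analysis"
begin

section \<open>Matrices indexed by countable ordinals\<close>

text \<open>
  As in HOL-Cardinals, an ordinal is represented by a well-order relation, its elements being
  those of the field of the relation. Every countable ordinal is represented
  over the type of natural numbers; the index types are left arbitrary so that the sum of
  ordinals can live on a sum type.
\<close>

definition positive_countable_ordinal :: "'a rel \<Rightarrow> bool" where
  "positive_countable_ordinal r \<longleftrightarrow> Well_order r \<and> Field r \<noteq> {} \<and> countable (Field r)"

text \<open>The ordinal 1, and the ordinal sum \<open>r + s\<close>: a copy of \<open>r\<close> followed by a copy of \<open>s\<close>.\<close>

definition ord_one :: "unit rel" where
  "ord_one = {((), ())}"

definition ord_sum :: "'a rel \<Rightarrow> 'b rel \<Rightarrow> ('a + 'b) rel" where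
  "ord_sum r s =
     {(Inl a, Inl a') | a a'. (a, a') \<in> r} \<union>
     {(Inr b, Inr b') | b b'. (b, b') \<in> s} \<union>
     {(Inl a, Inr b) | a b. a \<in> Field r \<and> b \<in> Field s}"

text \<open>
  A matrix of size \<open>row_ord \<times> col_ord\<close>. Only the entries with row index in \<open>Field row_ord\<close> and
  column index in \<open>Field col_ord\<close> are meaningful.
\<close>

record ('r, 'c) ord_matrix =
  row_ord :: "'r rel"
  col_ord :: "'c rel"
  entry :: "'r \<Rightarrow> 'c \<Rightarrow> rat"

definition row_support :: "('r, 'c) ord_matrix \<Rightarrow> 'r \<Rightarrow> 'c set" where
  "row_support N i = {j \<in> Field (col_ord N). entry N i j \<noteq> 0}"

definition admissible :: "('r, 'c) ord_matrix \<Rightarrow> bool" where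
  "admissible N \<longleftrightarrow>
     positive_countable_ordinal (row_ord N) \<and>
     positive_countable_ordinal (col_ord N) \<and>
     (\<forall>i \<in> Field (row_ord N). row_support N i \<noteq> {} \<and> finite (row_support N i))"

definition mat_vec :: "('r, 'c) ord_matrix \<Rightarrow> ('c \<Rightarrow> real) \<Rightarrow> 'r \<Rightarrow> real" where
  "mat_vec N x i = (\<Sum>j \<in> row_support N i. of_rat (entry N i j) * x j)"

text \<open>
  The block matrix with rows \<open>(1 B 0)\<close> and \<open>(0 0 M)\<close>, the first block column being a single
  column. It has size \<open>(\<alpha> + \<gamma>) \<times> (1 + (\<delta> + \<mu>))\<close> if \<open>B\<close> is \<open>\<alpha> \<times> \<delta>\<close> and \<open>M\<close> is \<open>\<gamma> \<times> \<mu>\<close>.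
\<close>

fun block_entry ::
  "('a \<Rightarrow> 'b \<Rightarrow> rat) \<Rightarrow> ('c \<Rightarrow> 'd \<Rightarrow> rat) \<Rightarrow> 'a + 'c \<Rightarrow> unit + ('b + 'd) \<Rightarrow> rat" where
  "block_entry b m (Inl i) (Inl u) = 1"
| "block_entry b m (Inl i) (Inr (Inl j)) = b i j"
| "block_entry b m (Inl i) (Inr (Inr l)) = 0"
| "block_entry b m (Inr k) (Inl u) = 0"
| "block_entry b m (Inr k) (Inr (Inl j)) = 0"
| "block_entry b m (Inr k) (Inr (Inr l)) = m k l"

definition block_matrix ::
  "('a, 'b) ord_matrix \<Rightarrow> ('c, 'd) ord_matrix \<Rightarrow> ('a + 'c, unit + ('b + 'd)) ord_matrix" where
  "block_matrix B M =
     \<lparr> row_ord = ord_sum (row_ord B) (row_ord M),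
       col_ord = ord_sum ord_one (ord_sum (col_ord B) (col_ord M)),
       entry = block_entry (entry B) (entry M) \<rparr>"

section \<open>Ultrafilters near zero\<close>

definition ultrafilter_on :: "'a set \<Rightarrow> 'a set set \<Rightarrow> bool" where
  "ultrafilter_on S p \<longleftrightarrow>
     p \<subseteq> Pow S \<and> S \<in> p \<and> {} \<notin> p \<and>
     (\<forall>A \<in> p. \<forall>B \<in> p. A \<inter> B \<in> p) \<and>
     (\<forall>A \<in> p. \<forall>B. A \<subseteq> B \<and> B \<subseteq> S \<longrightarrow> B \<in> p) \<and>
     (\<forall>A. A \<subseteq> S \<longrightarrow> A \<in> p \<or> S - A \<in> p)"

definition beta :: "'a set \<Rightarrow> 'a set set set" where
  "beta S = {p. ultrafilter_on S p}"

text \<open>The set of ultrafilters denoted by an overline.\<close>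

definition uf_closure :: "'a set \<Rightarrow> 'a set \<Rightarrow> 'a set set set" where
  "uf_closure S C = {p \<in> beta S. C \<in> p}"

text \<open>The inner set is \<open>-x + B\<close>, formed in \<open>S\<close>.\<close>

definition uf_add :: "real set \<Rightarrow> real set set \<Rightarrow> real set set \<Rightarrow> real set set" where
  "uf_add S p q = {B. B \<subseteq> S \<and> {x \<in> S. {y \<in> S. x + y \<in> B} \<in> q} \<in> p}"

definition O_plus :: "real set \<Rightarrow> real set set set" where
  "O_plus S = {p \<in> beta S. \<forall>\<epsilon>>0. {0<..<\<epsilon>} \<inter> S \<in> p}"

definition left_ideal_O_plus :: "real set \<Rightarrow> real set set set \<Rightarrow> bool" where
  "left_ideal_O_plus S L \<longleftrightarrow>
     L \<noteq> {} \<and> L \<subseteq> O_plus S \<and> (\<forall>p \<in> O_plus S. \<forall>q \<in> L. uf_add S p q \<in> L)"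

definition thick_near_zero :: "real set \<Rightarrow> real set \<Rightarrow> bool" where
  "thick_near_zero S T \<longleftrightarrow>
     T \<subseteq> S \<and> (\<exists>L. left_ideal_O_plus S L \<and> L \<subseteq> uf_closure S T)"

text \<open>
  A finite colouring of \<open>T\<close> is a function on \<open>T\<close> with finite range; natural numbers serve as
  colours.
\<close>

definition M_zero :: "real set \<Rightarrow> ('r, 'c) ord_matrix set" where
  "M_zero S =
     {N. admissible N \<and>
         (\<forall>T. thick_near_zero S T \<longrightarrow>
            (\<forall>col :: real \<Rightarrow> nat. finite (col ` T) \<longrightarrow>
               (\<exists>x k. (\<forall>j \<in> Field (col_ord N). x j \<in> S) \<and>
                      (\<forall>i \<in> Field (row_ord N). mat_vec N x i \<in> {t \<in> T. col t = k}))))}"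

end

theory Submission
  imports Defs
begin

text \<open>
  For \<open>l\<close> in \<open>O\<^sup>+(S)\<close> the closed left ideal \<open>O\<^sup>+(S) + l\<close> is the set of ultrafilters extending
  an explicit filter, whose members are exactly the sets whose closure contains that ideal; so
  its members are thick near zero. By compactness, a matrix in \<open>M\<^sub>0(S)\<close> yields in each such
  ideal an ultrafilter all of whose members contain an image of the matrix. Given a thick \<open>T\<close>,
  whose closure contains some \<open>O\<^sup>+(S) + l\<close>, choose such a \<open>p\<close> in \<open>O\<^sup>+(S) + l\<close> for \<open>B\<close>, and then
  such a \<open>q\<close> in \<open>O\<^sup>+(S) + p\<close> for \<open>M\<close>. If \<open>A \<in> q\<close>, then \<open>-x + A \<in> p\<close> for some \<open>x \<in> S\<close>, so \<open>A\<close> contains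
  a translate by \<open>x\<close> of an image of \<open>B\<close> as well as an image of \<open>M\<close>. Take for \<open>A\<close> the colour class
  of \<open>T\<close> that lies in \<open>q\<close>.
\<close>

section \<open>Ultrafilters\<close>

lemma ultrafilter_on_Int: "ultrafilter_on S p \<Longrightarrow> A \<in> p \<Longrightarrow> B \<in> p \<Longrightarrow> A \<inter> B \<in> p"
  unfolding ultrafilter_on_def by blast

lemma ultrafilter_on_mono: "ultrafilter_on S p \<Longrightarrow> A \<in> p \<Longrightarrow> A \<subseteq> B \<Longrightarrow> B \<subseteq> S \<Longrightarrow> B \<in> p"
  unfolding ultrafilter_on_def by blast

lemma ultrafilter_on_subset: "ultrafilter_on S p \<Longrightarrow> A \<in> p \<Longrightarrow> A \<subseteq> S"
  unfolding ultrafilter_on_def by blast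

lemma ultrafilter_on_Diff_iff:
  assumes "ultrafilter_on S p" "A \<subseteq> S"
  shows "S - A \<in> p \<longleftrightarrow> A \<notin> p"
proof
  assume "S - A \<in> p"
  then show "A \<notin> p"
    using ultrafilter_on_Int[OF assms(1), of A "S - A"] assms(1)
    by (auto simp: ultrafilter_on_def)
next
  assume "A \<notin> p"
  then show "S - A \<in> p" using assms unfolding ultrafilter_on_def by blast
qed

lemma ultrafilter_on_finite_Union:
  assumes p: "ultrafilter_on S p" and "finite I" "(\<Union>i\<in>I. A i) \<in> p"
  shows "\<exists>i\<in>I. A i \<in> p"
  using assms(2,3)
proof (induction I)
  case empty
  then show ?case using p by (auto simp: ultrafilter_on_def)
next
  case (insert i I)
  show ?case
  proof (cases "A i \<in> p")
    case False
    have sub: "A i \<union> (\<Union>i\<in>I. A i) \<subseteq> S"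
      using ultrafilter_on_subset[OF p insert.prems] by simp
    then have "S - A i \<in> p" using False ultrafilter_on_Diff_iff[OF p] by auto
    from ultrafilter_on_Int[OF p this insert.prems]
    have "(\<Union>i\<in>I. A i) \<in> p" by (rule ultrafilter_on_mono[OF p]) (use sub in auto)
    then show ?thesis using insert.IH by blast
  qed auto
qed

text \<open>Zorn's lemma applied to the proper filters on \<open>S\<close> containing the filter
  base \<open>F\<close>. The upward closure of \<open>F\<close> is one of them, and the union of a
  nonempty chain of them is another. Maximality of a filter then yields the complement
  condition.\<close>

lemma ultrafilter_on_exists:
  assumes "F \<noteq> {}" "F \<subseteq> Pow S" "{} \<notin> F"
    and dir: "\<And>A B. A \<in> F \<Longrightarrow> B \<in> F \<Longrightarrow> \<exists>C\<in>F. C \<subseteq> A \<inter> B"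
  obtains p where "ultrafilter_on S p" "F \<subseteq> p"
proof -
  define filt where "filt G \<longleftrightarrow> F \<subseteq> G \<and> G \<subseteq> Pow S \<and> {} \<notin> G \<and> (\<forall>A\<in>G. \<forall>B\<in>G. A \<inter> B \<in> G) \<and>
    (\<forall>A\<in>G. \<forall>B. A \<subseteq> B \<and> B \<subseteq> S \<longrightarrow> B \<in> G)" for G
  have "filt {X. X \<subseteq> S \<and> (\<exists>A\<in>F. A \<subseteq> X)}"
    unfolding filt_def
  proof (intro conjI ballI allI impI)
    fix A B
    assume "A \<in> {X. X \<subseteq> S \<and> (\<exists>A\<in>F. A \<subseteq> X)}" "B \<in> {X. X \<subseteq> S \<and> (\<exists>A\<in>F. A \<subseteq> X)}"
    then obtain A' B' where "A' \<in> F" "A' \<subseteq> A" "B' \<in> F" "B' \<subseteq> B" "A \<subseteq> S" by blast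
    with dir[of A' B'] show "A \<inter> B \<in> {X. X \<subseteq> S \<and> (\<exists>A\<in>F. A \<subseteq> X)}" by blast
  qed (use assms(2,3) in \<open>(blast | fastforce)+\<close>)
  then have "{G. filt G} \<noteq> {}" by blast
  moreover have "\<Union>C \<in> {G. filt G}" if C: "C \<noteq> {}" "subset.chain {G. filt G} C" for C
  proof -
    have "filt G" if "G \<in> C" for G
      using C(2) that unfolding subset_chain_def by blast
    then have filtC: "F \<subseteq> G" "G \<subseteq> Pow S" "{} \<notin> G"
      "\<And>A B. A \<in> G \<Longrightarrow> B \<in> G \<Longrightarrow> A \<inter> B \<in> G"
      "\<And>A B. A \<in> G \<Longrightarrow> A \<subseteq> B \<Longrightarrow> B \<subseteq> S \<Longrightarrow> B \<in> G" if "G \<in> C" for G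
      using that unfolding filt_def by simp_all
    have Int: "A \<inter> B \<in> \<Union>C" if AB: "A \<in> \<Union>C" "B \<in> \<Union>C" for A B
    proof -
      obtain G H where GH: "G \<in> C" "A \<in> G" "H \<in> C" "B \<in> H" using AB by blast
      then have "G \<subseteq> H \<or> H \<subseteq> G" using C(2) unfolding subset_chain_def by blast
      then obtain K where K: "K \<in> C" "A \<in> K" "B \<in> K" using GH by blast
      then show ?thesis using filtC(4)[OF K(1)] by blast
    qed
    have up: "B \<in> \<Union>C" if AB: "A \<in> \<Union>C" "A \<subseteq> B" "B \<subseteq> S" for A B
    proof -
      obtain G where G: "G \<in> C" "A \<in> G" using AB(1) by blast
      then have "B \<in> G" using filtC(5)[OF G(1)] AB(2,3) by simp
      then show ?thesis using G(1) by blast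
    qed
    obtain G where G: "G \<in> C" using C(1) by blast
    have "F \<subseteq> \<Union>C" using filtC(1)[OF G] G by blast
    moreover have "G \<subseteq> Pow S - {{}}" if "G \<in> C" for G
      using filtC(2,3)[OF that] by blast
    then have "\<Union>C \<subseteq> Pow S" "{} \<notin> \<Union>C" by blast+
    ultimately show ?thesis unfolding mem_Collect_eq filt_def using Int up by simp
  qed
  ultimately obtain p where p: "filt p" and max: "\<And>G. filt G \<Longrightarrow> p \<subseteq> G \<Longrightarrow> G = p"
    using subset_Zorn_nonempty[of "{G. filt G}"] by auto
  have F: "F \<subseteq> p" and sub: "p \<subseteq> Pow S" and ne: "{} \<notin> p"
    and Int: "\<And>A B. A \<in> p \<Longrightarrow> B \<in> p \<Longrightarrow> A \<inter> B \<in> p"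
    and up: "\<And>A B. A \<in> p \<Longrightarrow> A \<subseteq> B \<Longrightarrow> B \<subseteq> S \<Longrightarrow> B \<in> p"
    using p unfolding filt_def by auto
  have S: "S \<in> p" using F up assms(1) assms(2) by blast
  have "A \<in> p" if A: "A \<subseteq> S" "S - A \<notin> p" for A
  proof -
    \<comment> \<open>\<open>?G\<close> is the filter generated by \<open>p\<close> and
      \<open>A\<close>. It is proper because a member of \<open>p\<close> disjoint from
      \<open>A\<close> would put \<open>S - A\<close> into \<open>p\<close>. Maximality forces
      \<open>?G = p\<close>, and \<open>A\<close> is in \<open>?G\<close> because \<open>S\<close>
      is in \<open>p\<close>.\<close>
    let ?G = "{X. X \<subseteq> S \<and> (\<exists>B\<in>p. B \<inter> A \<subseteq> X)}"
    have pG: "p \<subseteq> ?G" using sub by auto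
    have "{} \<notin> ?G"
    proof
      assume "{} \<in> ?G"
      then obtain B where B: "B \<in> p" "B \<inter> A \<subseteq> {}" by blast
      then have "B \<subseteq> S - A" using sub by blast
      then show False using up[OF B(1)] A(2) by blast
    qed
    moreover have "X \<inter> Y \<in> ?G" if XY: "X \<in> ?G" "Y \<in> ?G" for X Y
    proof -
      obtain X' Y' where "X' \<in> p" "X' \<inter> A \<subseteq> X" "Y' \<in> p" "Y' \<inter> A \<subseteq> Y" "X \<subseteq> S"
        using XY by blast
      moreover from this have "X' \<inter> Y' \<in> p" using Int by blast
      ultimately show ?thesis by blast
    qed
    moreover have "Y \<in> ?G" if "X \<in> ?G" "X \<subseteq> Y" "Y \<subseteq> S" for X Y
      using that by blast
    moreover have "F \<subseteq> ?G" using F pG by (rule subset_trans)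
    moreover have "?G \<subseteq> Pow S" by auto
    ultimately have "filt ?G"
      unfolding filt_def by (metis (no_types, lifting))
    from max[OF this pG] have "?G = p" .
    moreover have "A \<in> ?G" using S A(1) by auto
    ultimately show ?thesis by simp
  qed
  then have "ultrafilter_on S p"
    unfolding ultrafilter_on_def using sub S ne Int up by (metis (no_types, lifting))
  with F that show ?thesis by blast
qed

section \<open>The filter of a principal left ideal\<close>

lemma O_plus_ultrafilter: "p \<in> O_plus S \<Longrightarrow> ultrafilter_on S p"
  by (simp add: O_plus_def beta_def)

lemma O_plus_interval: "p \<in> O_plus S \<Longrightarrow> 0 < \<epsilon> \<Longrightarrow> {0<..<\<epsilon>} \<inter> S \<in> p"
  by (simp add: O_plus_def)

section \<open>Sums of ultrafilters\<close>

lemma mem_uf_add_iff: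
  "A \<in> uf_add S p q \<longleftrightarrow> A \<subseteq> S \<and> {x \<in> S. {y \<in> S. x + y \<in> A} \<in> q} \<in> p"
  by (simp add: uf_add_def)

text \<open>The map \<open>?D\<close>, sending \<open>A\<close> to the set of \<open>x\<close> with
  \<open>-x + A\<close> in \<open>q\<close>, respects inclusion, intersection and complement because
  \<open>q\<close> is an ultrafilter. The conditions for the sum are therefore those for
  \<open>p\<close>, pulled back along \<open>?D\<close>.\<close>

lemma ultrafilter_on_uf_add:
  assumes clos: "\<And>x y. x \<in> S \<Longrightarrow> y \<in> S \<Longrightarrow> x + y \<in> S"
    and p: "ultrafilter_on S p" and q: "ultrafilter_on S q"
  shows "ultrafilter_on S (uf_add S p q)"
  unfolding ultrafilter_on_def
proof (intro conjI ballI allI impI)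
  let ?D = "\<lambda>A. {x \<in> S. {y \<in> S. x + y \<in> A} \<in> q}"
  have Sp: "S \<in> p" and Sq: "S \<in> q" and ep: "{} \<notin> p" and eq: "{} \<notin> q"
    using p q unfolding ultrafilter_on_def by blast+
  show "uf_add S p q \<subseteq> Pow S" by (auto simp: uf_add_def)
  have "{y \<in> S. x + y \<in> S} = S" if "x \<in> S" for x using clos that by auto
  then have "?D S = S" using Sq by auto
  then show "S \<in> uf_add S p q" using Sp by (simp add: mem_uf_add_iff)
  show "{} \<notin> uf_add S p q" using ep eq by (simp add: mem_uf_add_iff)
  show "A \<inter> B \<in> uf_add S p q" if "A \<in> uf_add S p q" "B \<in> uf_add S p q" for A B
  proof -
    have "?D A \<inter> ?D B \<in> p" using that ultrafilter_on_Int[OF p] by (simp add: mem_uf_add_iff)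
    moreover have "?D A \<inter> ?D B \<subseteq> ?D (A \<inter> B)"
    proof
      fix x assume "x \<in> ?D A \<inter> ?D B"
      moreover have "{y \<in> S. x + y \<in> A \<inter> B} = {y \<in> S. x + y \<in> A} \<inter> {y \<in> S. x + y \<in> B}" by auto
      ultimately show "x \<in> ?D (A \<inter> B)" using ultrafilter_on_Int[OF q] by auto
    qed
    ultimately have "?D (A \<inter> B) \<in> p" using ultrafilter_on_mono[OF p] by blast
    then show ?thesis using that by (auto simp: mem_uf_add_iff)
  qed
  show "B \<in> uf_add S p q" if "A \<in> uf_add S p q" and AB: "A \<subseteq> B \<and> B \<subseteq> S" for A B
  proof -
    have "?D A \<in> p" using that by (simp add: mem_uf_add_iff)
    moreover have "?D A \<subseteq> ?D B"
    proof
      fix x assume "x \<in> ?D A"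
      then show "x \<in> ?D B"
        using ultrafilter_on_mono[OF q, of "{y \<in> S. x + y \<in> A}" "{y \<in> S. x + y \<in> B}"] AB by auto
    qed
    ultimately have "?D B \<in> p" using ultrafilter_on_mono[OF p] by blast
    then show ?thesis using AB by (simp add: mem_uf_add_iff)
  qed
  show "A \<in> uf_add S p q \<or> S - A \<in> uf_add S p q" if A: "A \<subseteq> S" for A
  proof -
    have "?D (S - A) = S - ?D A"
    proof -
      have "{y \<in> S. x + y \<in> S - A} = S - {y \<in> S. x + y \<in> A}" if "x \<in> S" for x
        using clos that by auto
      then show ?thesis using ultrafilter_on_Diff_iff[OF q, of "{y \<in> S. _ + y \<in> A}"] by auto
    qed
    moreover have "?D A \<in> p \<or> S - ?D A \<in> p" using ultrafilter_on_Diff_iff[OF p, of "?D A"] by auto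
    ultimately show ?thesis using A by (auto simp: mem_uf_add_iff)
  qed
qed

text \<open>Read "C is in p" as "p-almost every x is in C". Then a set \<open>A\<close> lies in
  either side iff for p-almost every x, q-almost every y and r-almost every z the sum x + y + z is
  in \<open>A\<close>.\<close>

lemma uf_add_assoc:
  assumes clos: "\<And>x y. x \<in> S \<Longrightarrow> y \<in> S \<Longrightarrow> x + y \<in> S"
  shows "uf_add S (uf_add S p q) r = uf_add S p (uf_add S q r)"
proof -
  have "{y \<in> S. x + y \<in> {z \<in> S. {w \<in> S. z + w \<in> A} \<in> r}}
      = {y \<in> S. {w \<in> S. y + w \<in> {z \<in> S. x + z \<in> A}} \<in> r}" if "x \<in> S" for x A
  proof -
    have "{w \<in> S. x + y + w \<in> A} = {w \<in> S. y + w \<in> {z \<in> S. x + z \<in> A}}" if "y \<in> S" for y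
      using clos that by (auto simp: add.assoc)
    then show ?thesis using clos that by auto
  qed
  then have "{x \<in> S. {y \<in> S. x + y \<in> {z \<in> S. {w \<in> S. z + w \<in> A} \<in> r}} \<in> q}
      = {x \<in> S. {z \<in> S. x + z \<in> A} \<in> uf_add S q r}" for A
    by (auto simp: mem_uf_add_iff)
  then show ?thesis by (auto simp: uf_add_def)
qed

lemma uf_add_O_plus:
  assumes clos: "\<And>x y. x \<in> S \<Longrightarrow> y \<in> S \<Longrightarrow> x + y \<in> S"
    and p: "p \<in> O_plus S" and q: "q \<in> O_plus S"
  shows "uf_add S p q \<in> O_plus S"
proof -
  have "{0<..<\<epsilon>} \<inter> S \<in> uf_add S p q" if "0 < \<epsilon>" for \<epsilon>
  proof -
    have "{0<..<\<epsilon>/2} \<inter> S \<subseteq> {x \<in> S. {y \<in> S. x + y \<in> {0<..<\<epsilon>} \<inter> S} \<in> q}"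
    proof
      fix x assume x: "x \<in> {0<..<\<epsilon>/2} \<inter> S"
      have "{y \<in> S. x + y \<in> {0<..<\<epsilon>} \<inter> S} \<in> q"
        by (rule ultrafilter_on_mono[OF O_plus_ultrafilter[OF q] O_plus_interval[OF q, of "\<epsilon>/2"]])
          (use x that clos in auto)
      then show "x \<in> {x \<in> S. {y \<in> S. x + y \<in> {0<..<\<epsilon>} \<inter> S} \<in> q}" using x by blast
    qed
    then have "{x \<in> S. {y \<in> S. x + y \<in> {0<..<\<epsilon>} \<inter> S} \<in> q} \<in> p"
      by (rule ultrafilter_on_mono[OF O_plus_ultrafilter[OF p] O_plus_interval[OF p, of "\<epsilon>/2"], rotated])
        (use that in auto)
    then show ?thesis by (auto simp: mem_uf_add_iff)
  qed
  then show ?thesis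
    using ultrafilter_on_uf_add[OF clos O_plus_ultrafilter[OF p] O_plus_ultrafilter[OF q]]
    by (simp add: O_plus_def beta_def)
qed

section \<open>The filter attached to an ultrafilter near zero\<close>

text \<open>For \<open>l\<close> in \<open>O_plus S\<close> this is the intersection of all
  \<open>uf_add S r l\<close> with \<open>r\<close> in \<open>O_plus S\<close>: a set lies in every
  such \<open>r\<close> exactly when it contains some interval (0, \<epsilon>) of \<open>S\<close>.
  Membership of an ultrafilter \<open>p\<close> in the closed left ideal generated by
  \<open>l\<close> is thus written \<open>ideal_filter S l \<subseteq> p\<close>.\<close>

definition ideal_filter :: "real set \<Rightarrow> real set set \<Rightarrow> real set set" where
  "ideal_filter S l =
     {A. A \<subseteq> S \<and> (\<exists>\<epsilon>>0. \<forall>x \<in> {0<..<\<epsilon>} \<inter> S. {y \<in> S. x + y \<in> A} \<in> l)}"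

lemma ideal_filter_Int:
  assumes l: "ultrafilter_on S l" and A: "A \<in> ideal_filter S l" and B: "B \<in> ideal_filter S l"
  shows "A \<inter> B \<in> ideal_filter S l"
proof -
  obtain a where a: "a > 0" "\<And>x. x \<in> {0<..<a} \<inter> S \<Longrightarrow> {y \<in> S. x + y \<in> A} \<in> l"
    using A unfolding ideal_filter_def by blast
  obtain b where b: "b > 0" "\<And>x. x \<in> {0<..<b} \<inter> S \<Longrightarrow> {y \<in> S. x + y \<in> B} \<in> l"
    using B unfolding ideal_filter_def by blast
  have "{y \<in> S. x + y \<in> A \<inter> B} \<in> l" if "x \<in> {0<..<min a b} \<inter> S" for x
  proof -
    have "{y \<in> S. x + y \<in> A \<inter> B} = {y \<in> S. x + y \<in> A} \<inter> {y \<in> S. x + y \<in> B}" by auto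
    then show ?thesis using a(2)[of x] b(2)[of x] that ultrafilter_on_Int[OF l] by auto
  qed
  moreover have "min a b > 0" using a b by simp
  ultimately show ?thesis using A unfolding ideal_filter_def by blast
qed

lemma ideal_filter_interval:
  assumes clos: "\<And>x y. x \<in> S \<Longrightarrow> y \<in> S \<Longrightarrow> x + y \<in> S"
    and l: "l \<in> O_plus S" and "0 < \<epsilon>"
  shows "{0<..<\<epsilon>} \<inter> S \<in> ideal_filter S l"
proof -
  have "{y \<in> S. x + y \<in> {0<..<\<epsilon>} \<inter> S} \<in> l" if "x \<in> {0<..<\<epsilon>/2} \<inter> S" for x
    by (rule ultrafilter_on_mono[OF O_plus_ultrafilter[OF l] O_plus_interval[OF l, of "\<epsilon>/2"]])
      (use that clos assms(3) in auto)
  moreover have "\<epsilon>/2 > 0" using assms(3) by simp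
  ultimately show ?thesis unfolding ideal_filter_def by blast
qed

lemma ideal_filter_subset_imp_O_plus:
  assumes clos: "\<And>x y. x \<in> S \<Longrightarrow> y \<in> S \<Longrightarrow> x + y \<in> S"
    and "l \<in> O_plus S" "ultrafilter_on S p" "ideal_filter S l \<subseteq> p"
  shows "p \<in> O_plus S"
  using ideal_filter_interval[OF clos assms(2)] assms(3,4)
  by (auto simp: O_plus_def beta_def)

text \<open>The witnessing left ideal consists of the sums \<open>uf_add S r l\<close>. It absorbs
  addition from the left by associativity, and each sum contains \<open>A\<close> because
  \<open>r\<close> contains the interval on which \<open>-x + A\<close> is in
  \<open>l\<close>.\<close>

lemma ideal_filter_imp_thick_near_zero:
  assumes clos: "\<And>x y. x \<in> S \<Longrightarrow> y \<in> S \<Longrightarrow> x + y \<in> S"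
    and l: "l \<in> O_plus S" and A: "A \<in> ideal_filter S l"
  shows "thick_near_zero S A"
proof -
  let ?L = "(\<lambda>r. uf_add S r l) ` O_plus S"
  have "left_ideal_O_plus S ?L"
    unfolding left_ideal_O_plus_def
    using l uf_add_O_plus[OF clos] uf_add_assoc[OF clos, symmetric] by auto
  moreover have "?L \<subseteq> uf_closure S A"
  proof
    fix s assume "s \<in> ?L"
    then obtain r where r: "r \<in> O_plus S" "s = uf_add S r l" by blast
    obtain \<epsilon> where e: "\<epsilon> > 0" "\<And>x. x \<in> {0<..<\<epsilon>} \<inter> S \<Longrightarrow> {y \<in> S. x + y \<in> A} \<in> l"
      using A unfolding ideal_filter_def by blast
    have "{x \<in> S. {y \<in> S. x + y \<in> A} \<in> l} \<in> r"
      by (rule ultrafilter_on_mono[OF O_plus_ultrafilter[OF r(1)] O_plus_interval[OF r(1) e(1)]])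
        (use e(2) in auto)
    then show "s \<in> uf_closure S A"
      using r A uf_add_O_plus[OF clos r(1) l]
      by (auto simp: uf_closure_def mem_uf_add_iff O_plus_def ideal_filter_def)
  qed
  moreover have "A \<subseteq> S" using A by (simp add: ideal_filter_def)
  ultimately show ?thesis unfolding thick_near_zero_def by blast
qed

text \<open>Any \<open>l\<close> in the given left ideal works. Since \<open>uf_add S r l\<close>
  stays in the ideal, the set \<open>X\<close> of all \<open>x\<close> with \<open>-x + T\<close> in
  \<open>l\<close> belongs to every \<open>r\<close> in \<open>O_plus S\<close>. If \<open>X\<close>
  contained no interval at zero, the sets in \<open>?F\<close> would form a filter base, and an
  ultrafilter extending it would lie in \<open>O_plus S\<close> and omit \<open>X\<close>.\<close>

lemma thick_near_zero_imp_ideal_filter: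
  assumes "thick_near_zero S T"
  obtains l where "l \<in> O_plus S" "T \<in> ideal_filter S l"
proof -
  obtain L where L: "left_ideal_O_plus S L" "L \<subseteq> uf_closure S T" and T: "T \<subseteq> S"
    using assms unfolding thick_near_zero_def by blast
  then obtain l where l: "l \<in> L" "l \<in> O_plus S" unfolding left_ideal_O_plus_def by blast
  define X where "X = {x \<in> S. {y \<in> S. x + y \<in> T} \<in> l}"
  have X: "X \<in> r" if "r \<in> O_plus S" for r
  proof -
    have "uf_add S r l \<in> L" using L(1) l(1) that unfolding left_ideal_O_plus_def by blast
    then show ?thesis using L(2) by (auto simp: uf_closure_def mem_uf_add_iff X_def)
  qed
  have "T \<in> ideal_filter S l"
  proof (rule ccontr)
    assume notin: "T \<notin> ideal_filter S l"
    let ?F = "(\<lambda>\<epsilon>. {0<..<\<epsilon>} \<inter> S - X) ` {0<..}"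
    have "{0<..<\<epsilon>} \<inter> S - X \<noteq> {}" if "0 < \<epsilon>" for \<epsilon>
      using notin T that unfolding ideal_filter_def X_def by blast
    then have "{} \<notin> ?F" by fastforce
    moreover have "\<exists>C\<in>?F. C \<subseteq> A \<inter> B" if "A \<in> ?F" "B \<in> ?F" for A B
    proof -
      obtain a b where "a > 0" "b > 0" "A = {0<..<a} \<inter> S - X" "B = {0<..<b} \<inter> S - X"
        using \<open>A \<in> ?F\<close> \<open>B \<in> ?F\<close> by auto
      then show ?thesis by (intro bexI[of _ "{0<..<min a b} \<inter> S - X"]) auto
    qed
    moreover have "?F \<noteq> {}" "?F \<subseteq> Pow S" by auto
    ultimately obtain r where r: "ultrafilter_on S r" "?F \<subseteq> r"
      using ultrafilter_on_exists[of ?F S] by metis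
    have F: "{0<..<\<epsilon>} \<inter> S - X \<in> r" if "0 < \<epsilon>" for \<epsilon> using r(2) that by blast
    then have "{0<..<\<epsilon>} \<inter> S \<in> r" if "0 < \<epsilon>" for \<epsilon>
      using ultrafilter_on_mono[OF r(1) F[OF that]] by blast
    then have "r \<in> O_plus S" using r(1) by (simp add: O_plus_def beta_def)
    then have "X \<inter> ({0<..<1} \<inter> S - X) \<in> r" using ultrafilter_on_Int[OF r(1) X F[of 1]] by simp
    moreover have "X \<inter> ({0<..<1} \<inter> S - X) = {}" by blast
    ultimately show False using r(1) by (simp add: ultrafilter_on_def)
  qed
  with l(2) that show ?thesis by blast
qed

text \<open>This carries thickness along from \<open>l\<close> to the \<open>p\<close> chosen in its
  ideal: being true of every \<open>T\<close>, it says that the ideal generated by \<open>p\<close>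
  lies inside the one generated by \<open>l\<close>.\<close>

lemma ideal_filter_shift:
  assumes clos: "\<And>x y. x \<in> S \<Longrightarrow> y \<in> S \<Longrightarrow> x + y \<in> S"
    and T: "T \<in> ideal_filter S l" and sub: "ideal_filter S l \<subseteq> p"
  shows "T \<in> ideal_filter S p"
proof -
  obtain \<epsilon> where e: "\<epsilon> > 0" "\<And>x. x \<in> {0<..<\<epsilon>} \<inter> S \<Longrightarrow> {y \<in> S. x + y \<in> T} \<in> l"
    using T unfolding ideal_filter_def by blast
  have "{y \<in> S. x + y \<in> T} \<in> p" if x: "x \<in> {0<..<\<epsilon>} \<inter> S" for x
  proof -
    \<comment> \<open>For fixed x < \<epsilon> there is still room \<epsilon> - x for z, so the
      translate \<open>-x + T\<close> is itself in the filter of \<open>l\<close>, and hence in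
      \<open>p\<close>.\<close>
    have "{w \<in> S. z + w \<in> {y \<in> S. x + y \<in> T}} \<in> l" if z: "z \<in> {0<..<\<epsilon> - x} \<inter> S" for z
    proof -
      have "{w \<in> S. z + w \<in> {y \<in> S. x + y \<in> T}} = {w \<in> S. (x + z) + w \<in> T}"
        using clos z by (auto simp: add.assoc)
      then show ?thesis using e(2)[of "x + z"] x z clos by auto
    qed
    moreover have "\<epsilon> - x > 0" using x by simp
    ultimately have "{y \<in> S. x + y \<in> T} \<in> ideal_filter S l" unfolding ideal_filter_def by blast
    then show ?thesis using sub by blast
  qed
  with e(1) T show ?thesis unfolding ideal_filter_def by blast
qed

section \<open>Images of matrices in ultrafilters\<close>

definition contains_image :: "real set \<Rightarrow> ('r, 'c) ord_matrix \<Rightarrow> real set \<Rightarrow> bool" where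
  "contains_image S N A \<longleftrightarrow>
     (\<exists>x. (\<forall>j \<in> Field (col_ord N). x j \<in> S) \<and> (\<forall>i \<in> Field (row_ord N). mat_vec N x i \<in> A))"

text \<open>Passes from colourings to covers whose members may overlap or leave \<open>A\<close>.
  Each point is coloured by one chosen member of \<open>K\<close> containing it, coded as a natural
  number by an injection.\<close>

lemma M_zero_finite_cover:
  assumes N: "N \<in> M_zero S" and A: "thick_near_zero S A" and K: "finite K" "A \<subseteq> \<Union>K"
  shows "\<exists>C\<in>K. contains_image S N C"
proof -
  obtain f :: "real set \<Rightarrow> nat" where f: "inj_on f K"
    using finite_imp_inj_to_nat_seg[OF K(1)] by blast
  define c where "c t = (SOME C. C \<in> K \<and> t \<in> C)" for t
  have c: "c t \<in> K" "t \<in> c t" if "t \<in> A" for t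
    using someI_ex[of "\<lambda>C. C \<in> K \<and> t \<in> C"] that K(2) unfolding c_def by blast+
  have "finite ((f \<circ> c) ` A)"
    by (rule finite_subset[of _ "f ` K"]) (use c K(1) in auto)
  then obtain x k where x: "\<And>j. j \<in> Field (col_ord N) \<Longrightarrow> x j \<in> S"
    and k: "\<And>i. i \<in> Field (row_ord N) \<Longrightarrow> mat_vec N x i \<in> A \<and> f (c (mat_vec N x i)) = k"
    using N A unfolding M_zero_def by fastforce
  \<comment> \<open>The row ordinal is positive, so some row exists; its value identifies which
    member of \<open>K\<close> the common colour stands for.\<close>
  obtain i where i: "i \<in> Field (row_ord N)"
    using N unfolding M_zero_def admissible_def positive_countable_ordinal_def by blast
  have "mat_vec N x j \<in> c (mat_vec N x i)" if j: "j \<in> Field (row_ord N)" for j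
  proof -
    have "c (mat_vec N x j) = c (mat_vec N x i)"
      using k[OF i] k[OF j] c f by (auto simp: inj_on_def)
    then show ?thesis using c(2)[of "mat_vec N x j"] k[OF j] by simp
  qed
  then have "contains_image S N (c (mat_vec N x i))" using x unfolding contains_image_def by blast
  then show ?thesis using c(1) k[OF i] by blast
qed

text \<open>A compactness argument. Removing finitely many sets without an image from a member of
  the filter never leaves the empty set: that member is thick near zero, so
  \<open>M_zero_finite_cover\<close> would give one of the removed sets an image. An ultrafilter
  containing all these differences has no set without an image.\<close>

lemma M_zero_ultrafilter:
  assumes clos: "\<And>x y. x \<in> S \<Longrightarrow> y \<in> S \<Longrightarrow> x + y \<in> S"
    and N: "N \<in> M_zero S" and l: "l \<in> O_plus S"
  obtains p where "p \<in> O_plus S" "ideal_filter S l \<subseteq> p" "\<And>A. A \<in> p \<Longrightarrow> contains_image S N A"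
proof -
  let ?bad = "\<lambda>K. finite K \<and> (\<forall>C\<in>K. C \<subseteq> S \<and> \<not> contains_image S N C)"
  let ?F = "{A - \<Union>K |A K. A \<in> ideal_filter S l \<and> ?bad K}"
  have in_F: "A - \<Union>K \<in> ?F" if "A \<in> ideal_filter S l" "?bad K" for A K
    using that by blast
  have sub: "ideal_filter S l \<subseteq> ?F"
    using in_F[of _ "{}"] by auto
  have S: "{0<..<1} \<inter> S \<in> ideal_filter S l"
    by (rule ideal_filter_interval[OF clos l]) auto
  then have ne: "?F \<noteq> {}" using sub by blast
  have Pow: "?F \<subseteq> Pow S" by (auto simp: ideal_filter_def)
  have empty: "{} \<notin> ?F"
  proof
    assume "{} \<in> ?F"
    then obtain A K where AK: "A \<in> ideal_filter S l" "?bad K" "A - \<Union>K = {}" by auto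
    then have "A \<subseteq> \<Union>K" by blast
    with AK M_zero_finite_cover[OF N ideal_filter_imp_thick_near_zero[OF clos l AK(1)]]
    show False by blast
  qed
  have dir: "\<exists>C\<in>?F. C \<subseteq> X \<inter> Y" if XY: "X \<in> ?F" "Y \<in> ?F" for X Y
  proof -
    obtain A K where A: "X = A - \<Union>K" "A \<in> ideal_filter S l" "?bad K" using XY(1) by blast
    obtain B H where B: "Y = B - \<Union>H" "B \<in> ideal_filter S l" "?bad H" using XY(2) by blast
    have "A \<inter> B - \<Union>(K \<union> H) \<in> ?F"
      by (rule in_F) (use A B ideal_filter_Int[OF O_plus_ultrafilter[OF l]] in auto)
    then show ?thesis by (rule bexI[rotated]) (use A B in auto)
  qed
  obtain p where p: "ultrafilter_on S p" "?F \<subseteq> p"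
    by (rule ultrafilter_on_exists[OF ne Pow empty dir])
  have lp: "ideal_filter S l \<subseteq> p" using sub p(2) by blast
  have "contains_image S N A" if A: "A \<in> p" for A
  proof (rule ccontr)
    assume "\<not> contains_image S N A"
    \<comment> \<open>With \<open>K = {A}\<close>, the difference of a filter member and
      \<open>A\<close> lies in \<open>p\<close> along with \<open>A\<close> itself.\<close>
    then have "?bad {A}" using ultrafilter_on_subset[OF p(1) A] by simp
    from in_F[OF S this] have "({0<..<1} \<inter> S - A) \<in> p" using p(2) by auto
    from ultrafilter_on_Int[OF p(1) A this] have "A \<inter> ({0<..<1} \<inter> S - A) \<in> p" .
    moreover have "A \<inter> ({0<..<1} \<inter> S - A) = {}" by blast
    ultimately show False using p(1) by (simp add: ultrafilter_on_def)
  qed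
  with that ideal_filter_subset_imp_O_plus[OF clos l p(1) lp] lp show ?thesis by blast
qed

section \<open>The block matrix\<close>

lemma ord_sum_simps [simp]:
  "(Inl a, Inl a') \<in> ord_sum r s \<longleftrightarrow> (a, a') \<in> r"
  "(Inr b, Inr b') \<in> ord_sum r s \<longleftrightarrow> (b, b') \<in> s"
  "(Inl a, Inr b) \<in> ord_sum r s \<longleftrightarrow> a \<in> Field r \<and> b \<in> Field s"
  "(Inr b, Inl a) \<notin> ord_sum r s"
  by (auto simp: ord_sum_def)

lemma Field_ord_sum: "Field (ord_sum r s) = Inl ` Field r \<union> Inr ` Field s"
proof
  show "Field (ord_sum r s) \<subseteq> Inl ` Field r \<union> Inr ` Field s"
    by (auto simp: ord_sum_def Field_def)
  have "Inl a \<in> Field (ord_sum r s)" if "a \<in> Field r" for a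
    using that unfolding Field_def Domain_iff Range_iff Un_iff by (metis ord_sum_simps(1))
  moreover have "Inr b \<in> Field (ord_sum r s)" if "b \<in> Field s" for b
    using that unfolding Field_def Domain_iff Range_iff Un_iff by (metis ord_sum_simps(2))
  ultimately show "Inl ` Field r \<union> Inr ` Field s \<subseteq> Field (ord_sum r s)" by auto
qed

lemma Well_order_ord_sum:
  assumes r: "Well_order r" and s: "Well_order s"
  shows "Well_order (ord_sum r s)"
proof -
  note defs = well_order_on_def linear_order_on_def partial_order_on_def preorder_on_def
  have "ord_sum r s \<subseteq> Field (ord_sum r s) \<times> Field (ord_sum r s)"
    by (auto intro: FieldI1 FieldI2)
  moreover have "Refl (ord_sum r s)"
    using r s unfolding defs refl_on_def Field_ord_sum by auto
  moreover have "trans (ord_sum r s)"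
  proof (rule transI)
    fix x y z assume "(x, y) \<in> ord_sum r s" "(y, z) \<in> ord_sum r s"
    moreover have "trans r" "trans s" using r s unfolding defs by auto
    ultimately show "(x, z) \<in> ord_sum r s"
      by (cases x; cases y; cases z) (auto dest: transD FieldI1 FieldI2)
  qed
  moreover have "antisym (ord_sum r s)"
  proof (rule antisymI)
    fix x y assume "(x, y) \<in> ord_sum r s" "(y, x) \<in> ord_sum r s"
    moreover have "antisym r" "antisym s" using r s unfolding defs by auto
    ultimately show "x = y"
      by (cases x; cases y) (auto dest: antisymD)
  qed
  moreover have "Total (ord_sum r s)"
    unfolding total_on_def
  proof (intro ballI impI)
    fix x y assume "x \<in> Field (ord_sum r s)" "y \<in> Field (ord_sum r s)" "x \<noteq> y"
    moreover have "Total r" "Total s" using r s unfolding defs by auto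
    ultimately show "(x, y) \<in> ord_sum r s \<or> (y, x) \<in> ord_sum r s"
      by (cases x; cases y) (auto simp: Field_ord_sum total_on_def)
  qed
  moreover have "wf (ord_sum r s - Id)"
    unfolding wf_eq_minimal
  proof (intro allI impI)
    fix Q :: "('a + 'b) set" and x assume x: "x \<in> Q"
    show "\<exists>z\<in>Q. \<forall>y. (y, z) \<in> ord_sum r s - Id \<longrightarrow> y \<notin> Q"
    \<comment> \<open>If \<open>Q\<close> meets the left summand, a minimal element there is minimal
      in \<open>Q\<close>, as nothing on the right precedes it. Otherwise \<open>Q\<close> lies
      wholly in the right summand.\<close>
    proof (cases "Inl -` Q = {}")
      case False
      moreover have "wf (r - Id)" using r unfolding defs by blast
      ultimately obtain z where z: "z \<in> Inl -` Q" "\<And>y. (y, z) \<in> r - Id \<Longrightarrow> y \<notin> Inl -` Q"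
        by (metis ex_in_conv wf_eq_minimal)
      have "y \<notin> Q" if "(y, Inl z) \<in> ord_sum r s - Id" for y
        using that z(2) by (cases y) auto
      with z(1) show ?thesis by blast
    next
      case True
      then have "Inr -` Q \<noteq> {}" using x by (cases x) auto
      moreover have "wf (s - Id)" using s unfolding defs by blast
      ultimately obtain z where z: "z \<in> Inr -` Q" "\<And>y. (y, z) \<in> s - Id \<Longrightarrow> y \<notin> Inr -` Q"
        by (metis ex_in_conv wf_eq_minimal)
      have "y \<notin> Q" if "(y, Inr z) \<in> ord_sum r s - Id" for y
        using that z(2) True by (cases y) auto
      with z(1) show ?thesis by blast
    qed
  qed
  ultimately show ?thesis unfolding defs by blast
qed

lemma positive_countable_ordinal_ord_sum:
  "positive_countable_ordinal r \<Longrightarrow> positive_countable_ordinal s \<Longrightarrow>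
    positive_countable_ordinal (ord_sum r s)"
  unfolding positive_countable_ordinal_def using Well_order_ord_sum[of r s]
  by (auto simp: Field_ord_sum)

lemma Field_ord_one [simp]: "Field ord_one = {()}"
  by (simp add: ord_one_def Field_def)

lemma positive_countable_ordinal_ord_one: "positive_countable_ordinal ord_one"
  using Field_ord_one
  by (auto simp: positive_countable_ordinal_def well_order_on_def linear_order_on_def
      partial_order_on_def preorder_on_def refl_on_def trans_def antisym_def total_on_def ord_one_def)

section \<open>Rows and images of the block matrix\<close>

lemma Field_row_ord_block_matrix:
  "Field (row_ord (block_matrix B M)) = Inl ` Field (row_ord B) \<union> Inr ` Field (row_ord M)"
  by (simp add: block_matrix_def Field_ord_sum)

lemma row_support_block_matrix:
  "row_support (block_matrix B M) (Inl i) = insert (Inl ()) ((\<lambda>j. Inr (Inl j)) ` row_support B i)"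
  "row_support (block_matrix B M) (Inr k) = (\<lambda>l. Inr (Inr l)) ` row_support M k"
  unfolding row_support_def block_matrix_def by (auto simp: Field_ord_sum)

lemma admissible_block_matrix:
  assumes "admissible B" "admissible M"
  shows "admissible (block_matrix B M)"
proof -
  have "positive_countable_ordinal (row_ord (block_matrix B M))"
    "positive_countable_ordinal (col_ord (block_matrix B M))"
    using assms positive_countable_ordinal_ord_one
    by (simp_all add: admissible_def block_matrix_def positive_countable_ordinal_ord_sum)
  then show ?thesis
    using assms by (auto simp: admissible_def row_support_block_matrix Field_row_ord_block_matrix)
qed

text \<open>In an upper row the term of the leading column is split off. Finiteness of the support
  matters here, since a sum over an infinite set is 0 by convention.\<close>

lemma mat_vec_block_matrix:
  "finite (row_support B i) \<Longrightarrow>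
    mat_vec (block_matrix B M) z (Inl i) = z (Inl ()) + mat_vec B (\<lambda>j. z (Inr (Inl j))) i"
  "mat_vec (block_matrix B M) z (Inr k) = mat_vec M (\<lambda>l. z (Inr (Inr l))) k"
proof -
  assume "finite (row_support B i)"
  then show "mat_vec (block_matrix B M) z (Inl i)
      = z (Inl ()) + mat_vec B (\<lambda>j. z (Inr (Inl j))) i"
    unfolding mat_vec_def row_support_block_matrix
    by (subst sum.insert) (auto simp: sum.reindex inj_on_def block_matrix_def)
next
  show "mat_vec (block_matrix B M) z (Inr k) = mat_vec M (\<lambda>l. z (Inr (Inr l))) k"
    unfolding mat_vec_def row_support_block_matrix
    by (simp add: sum.reindex inj_on_def block_matrix_def)
qed

text \<open>The three column blocks have independent variables: \<open>x0\<close> feeds the column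
  of ones and translates the image of \<open>B\<close>, while the image of \<open>M\<close> is
  unaffected.\<close>

lemma contains_image_block_matrix:
  assumes adm: "admissible B" and x0: "x0 \<in> S"
    and B: "contains_image S B {y \<in> S. x0 + y \<in> A}" and M: "contains_image S M A"
  shows "contains_image S (block_matrix B M) A"
proof -
  obtain x where x: "\<And>j. j \<in> Field (col_ord B) \<Longrightarrow> x j \<in> S"
    "\<And>i. i \<in> Field (row_ord B) \<Longrightarrow> x0 + mat_vec B x i \<in> A"
    using B unfolding contains_image_def by blast
  obtain y where y: "\<And>j. j \<in> Field (col_ord M) \<Longrightarrow> y j \<in> S"
    "\<And>i. i \<in> Field (row_ord M) \<Longrightarrow> mat_vec M y i \<in> A"
    using M unfolding contains_image_def by blast
  define z where "z = case_sum (\<lambda>_::unit. x0) (case_sum x y)"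
  have "\<forall>j \<in> Field (col_ord (block_matrix B M)). z j \<in> S"
    using x0 x(1) y(1) by (auto simp: block_matrix_def Field_ord_sum z_def)
  moreover have "mat_vec (block_matrix B M) z i \<in> A" if "i \<in> Field (row_ord (block_matrix B M))" for i
    using that x(2) y(2) adm
    by (auto simp: Field_row_ord_block_matrix mat_vec_block_matrix z_def admissible_def)
  ultimately show ?thesis unfolding contains_image_def by blast
qed

theorem theorem3p20:
  fixes S :: "real set"
    and B :: "('a, 'b) ord_matrix"
    and M :: "('c, 'd) ord_matrix"
  assumes "S \<subseteq> {0<..}"
    and "\<And>x y. x \<in> S \<Longrightarrow> y \<in> S \<Longrightarrow> x + y \<in> S"
    and "{0<..} \<subseteq> closure S"
    and "B \<in> M_zero S"
    and "M \<in> M_zero S"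
  shows "block_matrix B M \<in> M_zero S"
proof -
  note clos = assms(2)
  have adm: "admissible B" "admissible M" using assms(4,5) by (auto simp: M_zero_def)
  have "\<exists>x k. (\<forall>j \<in> Field (col_ord (block_matrix B M)). x j \<in> S) \<and>
      (\<forall>i \<in> Field (row_ord (block_matrix B M)). mat_vec (block_matrix B M) x i \<in> {t \<in> T. col t = k})"
    if T: "thick_near_zero S T" and col: "finite (col ` T)" for T and col :: "real \<Rightarrow> nat"
  proof -
    obtain l where l: "l \<in> O_plus S" "T \<in> ideal_filter S l"
      using thick_near_zero_imp_ideal_filter[OF T] .
    obtain p where p: "p \<in> O_plus S" "ideal_filter S l \<subseteq> p" "\<And>A. A \<in> p \<Longrightarrow> contains_image S B A"
      using M_zero_ultrafilter[OF clos assms(4) l(1)] by metis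
    obtain q where q: "q \<in> O_plus S" "ideal_filter S p \<subseteq> q" "\<And>A. A \<in> q \<Longrightarrow> contains_image S M A"
      using M_zero_ultrafilter[OF clos assms(5) p(1)] by metis
    note uf = O_plus_ultrafilter[OF p(1)] O_plus_ultrafilter[OF q(1)]
    \<comment> \<open>By the shift, \<open>T\<close> is still in the filter of \<open>p\<close>,
      which \<open>q\<close> extends; so one of its finitely many colour classes is in
      \<open>q\<close>.\<close>
    have "T \<in> q" using ideal_filter_shift[OF clos l(2) p(2)] q(2) by blast
    moreover have "T = (\<Union>k\<in>col ` T. {t \<in> T. col t = k})" by auto
    ultimately obtain k where A: "{t \<in> T. col t = k} \<in> q" (is "?A \<in> q")
      using ultrafilter_on_finite_Union[OF uf(2) col, of "\<lambda>k. {t \<in> T. col t = k}"] by auto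
    have "\<exists>x0\<in>S. {y \<in> S. x0 + y \<in> ?A} \<in> p"
    proof (rule ccontr)
      assume no: "\<not> ?thesis"
      \<comment> \<open>If no translate \<open>-x + ?A\<close> were in \<open>p\<close>, all
        translates of the complement would be. This puts \<open>S - ?A\<close> into the filter of
        \<open>p\<close> (any \<epsilon> serves, so 1 is taken) and hence into \<open>q\<close>,
        which already contains \<open>?A\<close>.\<close>
      have "{y \<in> S. x + y \<in> S - ?A} \<in> p" if "x \<in> S" for x
      proof -
        have "{y \<in> S. x + y \<in> S - ?A} = S - {y \<in> S. x + y \<in> ?A}" using clos that by auto
        then show ?thesis
          using no that ultrafilter_on_Diff_iff[OF uf(1), of "{y \<in> S. x + y \<in> ?A}"] by auto
      qed
      then have "S - ?A \<in> ideal_filter S p"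
        unfolding ideal_filter_def by (auto intro: exI[of _ 1])
      then show False
        using A q(2) ultrafilter_on_Diff_iff[OF uf(2) ultrafilter_on_subset[OF uf(2) A]] by blast
    qed
    then obtain x0 where "x0 \<in> S" "{y \<in> S. x0 + y \<in> ?A} \<in> p" by blast
    then have "contains_image S (block_matrix B M) ?A"
      using contains_image_block_matrix[OF adm(1)] p(3) q(3)[OF A] by blast
    then show ?thesis unfolding contains_image_def by blast
  qed
  then show ?thesis using admissible_block_matrix[OF adm] unfolding M_zero_def by blast
qed

end
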